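(* Fix $s\in\mathbb T^2$. Draw $T\sim\operatorname{Exp}(\lambda)$ (rate $\lambda$), independent of a Brownian motion $(\mathsf B_t)_{t\ge0}$ on $\mathbb T^2$ started at $s$, and generate an independent homogeneous Poisson process of rate $q_{\max}$ on $[0,T]$. At each event time $\tau_r$ (in increasing order), simulate the Brownian location $\mathsf B_{\tau_r}$ and generate an independent Bernoulli variable with success probability $q(\mathsf B_{\tau_r})/q_{\max}$ (a killing mark). Return zero at the first successful killing mark. If no killing mark succeeds before $T$, generate an independent Bernoulli variable with success probability $h(\mathsf B_T)/\lambda$ and return its outcome. Then the returned value $J_u(s)$ satisfies \[ J_u(s)\sim\operatorname{Bernoulli}(u(s)),\qquad u(s)=\mathbb E_s\!\left[\exp\!\left\{-\int_0^Tq(\mathsf B_t)\,\mathrm dt\right\}\frac{h(\mathsf B_T)}{\lambda}\right]. \]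
   Context: $\mathbb T^2$ is the two-dimensional torus, $\lambda>0$, $q_{\max}>0$, and $q,h:\mathbb T^2\to\mathbb R$ are Borel measurable functions with $0\le q(x)\le q_{\max}$ and $0\le h(x)\le\lambda$. $(\mathsf B_t)$ is Brownian motion on $\mathbb T^2$ with generator $\frac12\Delta$, and $\mathbb E_s$ denotes expectation for $\mathsf B_0=s$ and $T\sim\operatorname{Exp}(\lambda)$ independent of $\mathsf B$. The displayed $u$ is the resolvent Feynman--Kac representation of the solution of $(\lambda+q(x)-\frac12\Delta)u(x)=h(x)$ on $\mathbb T^2$; for the theorem, $u$ is defined by this expectation. *)

theory Defs
  imports "HOL-Probability.Probability"
begin

text \<open>The torus is the flat torus \<open>\<real>\<^sup>2/\<int>\<^sup>2\<close>, realised as the square of the circle \<open>\<real>/\<int>\<close>; group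
  structure and topology on the product are the library's product instances.\<close>

quotient_type circle = real / "\<lambda>x y :: real. x - y \<in> \<int>"
  morphisms circle_rep to_circle
proof (rule equivpI)
  show "reflp (\<lambda>x y :: real. x - y \<in> \<int>)"
    by (simp add: reflp_def)
  show "symp (\<lambda>x y :: real. x - y \<in> \<int>)"
    by (metis (no_types, lifting) Ints_minus minus_diff_eq sympI)
  show "transp (\<lambda>x y :: real. x - y \<in> \<int>)"
  proof (rule transpI)
    fix x y z :: real
    assume "x - y \<in> \<int>" "y - z \<in> \<int>"
    then have "(x - y) + (y - z) \<in> \<int>" by (rule Ints_add)
    then show "x - z \<in> \<int>" by simp
  qed
qed

instantiation circle :: ab_group_add
begin

lift_definition zero_circle :: circle is "0 :: real" .

lift_definition plus_circle :: "circle \<Rightarrow> circle \<Rightarrow> circle" is "(+) :: real \<Rightarrow> real \<Rightarrow> real"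
  by (metis Ints_add add_diff_add)

lift_definition uminus_circle :: "circle \<Rightarrow> circle" is "uminus :: real \<Rightarrow> real"
  by (metis Ints_minus minus_diff_minus)

lift_definition minus_circle :: "circle \<Rightarrow> circle \<Rightarrow> circle" is "(-) :: real \<Rightarrow> real \<Rightarrow> real"
proof -
  fix a b c d :: real
  assume "a - b \<in> \<int>" "c - d \<in> \<int>"
  then have "(a - b) - (c - d) \<in> \<int>" by (rule Ints_diff)
  then show "a - c - (b - d) \<in> \<int>" by (simp add: algebra_simps)
qed

instance
  by standard (transfer; simp)+

end

instantiation circle :: topological_space
begin

text \<open>Quotient topology.\<close>

definition open_circle :: "circle set \<Rightarrow> bool" where
  "open_circle U \<longleftrightarrow> open (to_circle -` U)"

instance
proof
  show "open (UNIV :: circle set)"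
    by (simp add: open_circle_def)
  show "open (S \<inter> U)" if "open S" "open U" for S U :: "circle set"
    using that by (simp add: open_circle_def vimage_Int open_Int)
  show "open (\<Union>K)" if "\<forall>S\<in>K. open S" for K :: "circle set set"
    using that by (auto simp: open_circle_def vimage_Union intro!: open_UN)
qed

end

type_synonym torus = "circle \<times> circle"

definition to_torus :: "real \<times> real \<Rightarrow> torus" where
  "to_torus = (\<lambda>(x, y). (to_circle x, to_circle y))"

definition planar_normal :: "real \<Rightarrow> (real \<times> real) measure" where
  "planar_normal \<sigma> =
     density lborel (\<lambda>x. ennreal (normal_density 0 \<sigma> x)) \<Otimes>\<^sub>M
     density lborel (\<lambda>y. ennreal (normal_density 0 \<sigma> y))"

text \<open>Brownian motion on the flat torus, as a continuous process with independent stationary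
  increments. An increment over a time span \<open>d\<close> is the image in \<open>\<real>\<^sup>2/\<int>\<^sup>2\<close> of a centred planar
  normal variable with covariance \<open>d\<close> times the identity, that is, its law is the heat kernel of
  half the Laplacian at time \<open>d\<close>. Only times \<open>t \<ge> 0\<close> are constrained. A finite partition
  \<open>t\<^sub>0 \<le> \<dots> \<le> t\<^sub>n\<close> is a monotone sequence that is constant from \<open>n\<close> on.\<close>

definition torus_brownian_motion ::
    "'w measure \<Rightarrow> torus \<Rightarrow> (real \<Rightarrow> 'w \<Rightarrow> torus) \<Rightarrow> bool" where
  "torus_brownian_motion M s B \<longleftrightarrow>
     (\<forall>t\<ge>0. B t \<in> borel_measurable M) \<and>
     (\<forall>\<omega>\<in>space M. B 0 \<omega> = s) \<and>
     (\<forall>\<omega>\<in>space M. continuous_on {0..} (\<lambda>t. B t \<omega>)) \<and>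
     (\<forall>t :: nat \<Rightarrow> real. 0 \<le> t 0 \<and> mono t \<longrightarrow>
        prob_space.indep_vars M (\<lambda>_. borel) (\<lambda>i \<omega>. B (t (Suc i)) \<omega> - B (t i) \<omega>) UNIV) \<and>
     (\<forall>r t. 0 \<le> r \<and> r < t \<longrightarrow>
        distr M borel (\<lambda>\<omega>. B t \<omega> - B r \<omega>) = distr (planar_normal (sqrt (t - r))) borel to_torus)"

text \<open>Independence of two random variables, as for \<open>indep_var\<close> but without the restriction that both
  take values in the same type.\<close>

definition indep_pair ::
    "'w measure \<Rightarrow> 'x measure \<Rightarrow> ('w \<Rightarrow> 'x) \<Rightarrow> 'y measure \<Rightarrow> ('w \<Rightarrow> 'y) \<Rightarrow> bool" where
  "indep_pair M N X L Y \<longleftrightarrow>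
     X \<in> measurable M N \<and> Y \<in> measurable M L \<and>
     prob_space.indep_set M
       {X -` A \<inter> space M | A. A \<in> sets N} {Y -` A \<inter> space M | A. A \<in> sets L}"

definition num_points :: "(nat \<Rightarrow> 'w \<Rightarrow> real) \<Rightarrow> real set \<Rightarrow> 'w \<Rightarrow> nat" where
  "num_points \<tau> A \<omega> = card {r. \<tau> r \<omega> \<in> A}"

text \<open>A homogeneous Poisson process on \<open>[0,\<infinity>)\<close>, given by its event times in increasing order
  (numbered from 0): the numbers of points in disjoint bounded Borel sets are independent Poisson
  variables. The Poisson weights are written out because \<open>poisson_pmf\<close> is only available
  for a nonzero parameter, whereas \<open>A\<close> may be a null set.\<close>

definition homogeneous_poisson_process ::
    "'w measure \<Rightarrow> real \<Rightarrow> (nat \<Rightarrow> 'w \<Rightarrow> real) \<Rightarrow> bool" where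
  "homogeneous_poisson_process M rate \<tau> \<longleftrightarrow>
     (\<forall>r. \<tau> r \<in> borel_measurable M) \<and>
     (\<forall>\<omega>\<in>space M. 0 \<le> \<tau> 0 \<omega> \<and> strict_mono (\<lambda>r. \<tau> r \<omega>) \<and>
        filterlim (\<lambda>r. \<tau> r \<omega>) at_top sequentially) \<and>
     (\<forall>A\<in>sets borel. bounded A \<and> A \<subseteq> {0..} \<longrightarrow>
        (\<forall>k. measure M {\<omega>\<in>space M. num_points \<tau> A \<omega> = k} =
           (rate * measure lborel A) ^ k / fact k * exp (- (rate * measure lborel A)))) \<and>
     (\<forall>A :: nat \<Rightarrow> real set.
        (\<forall>i. A i \<in> sets borel \<and> bounded (A i) \<and> A i \<subseteq> {0..}) \<and> disjoint_family A \<longrightarrow>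
        prob_space.indep_vars M (\<lambda>_. count_space UNIV) (\<lambda>i. num_points \<tau> (A i)) UNIV)"

definition path_space :: "(real \<Rightarrow> torus) measure" where
  "path_space = (\<Pi>\<^sub>M t\<in>{0..}. borel)"

definition sample_path :: "(real \<Rightarrow> 'w \<Rightarrow> torus) \<Rightarrow> 'w \<Rightarrow> real \<Rightarrow> torus" where
  "sample_path B \<omega> = (\<lambda>t\<in>{0..}. B t \<omega>)"

text \<open>\<open>K\<close> is a Bernoulli variable with the (random) success probability \<open>p\<close>, drawn independently
  of everything else given \<open>X\<close>: the conditional probability of success given \<open>X\<close> is \<open>p\<close>.\<close>

definition bernoulli_given ::
    "'w measure \<Rightarrow> 'x measure \<Rightarrow> ('w \<Rightarrow> 'x) \<Rightarrow> ('w \<Rightarrow> real) \<Rightarrow> ('w \<Rightarrow> bool) \<Rightarrow> bool" where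
  "bernoulli_given M N X p K \<longleftrightarrow>
     X \<in> measurable M N \<and> K \<in> measurable M (count_space UNIV) \<and>
     (AE \<omega> in M. real_cond_exp M (vimage_algebra (space M) X N) (\<lambda>\<omega>. of_bool (K \<omega>)) \<omega> = p \<omega>)"

text \<open>Everything drawn before a given Bernoulli variable: the Brownian path, the clock, the event
  times and the marks with index in \<open>I\<close>.\<close>

definition history_space ::
    "nat set \<Rightarrow> ((real \<Rightarrow> torus) \<times> real \<times> (nat \<Rightarrow> real) \<times> (nat \<Rightarrow> bool)) measure" where
  "history_space I =
     path_space \<Otimes>\<^sub>M (borel \<Otimes>\<^sub>M ((\<Pi>\<^sub>M r\<in>UNIV. borel) \<Otimes>\<^sub>M (\<Pi>\<^sub>M r\<in>I. count_space UNIV)))"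

definition history ::
    "(real \<Rightarrow> 'w \<Rightarrow> torus) \<Rightarrow> ('w \<Rightarrow> real) \<Rightarrow> (nat \<Rightarrow> 'w \<Rightarrow> real) \<Rightarrow> (nat \<Rightarrow> 'w \<Rightarrow> bool) \<Rightarrow> nat set \<Rightarrow>
     'w \<Rightarrow> (real \<Rightarrow> torus) \<times> real \<times> (nat \<Rightarrow> real) \<times> (nat \<Rightarrow> bool)" where
  "history B T \<tau> K I \<omega> = (sample_path B \<omega>, T \<omega>, (\<lambda>r. \<tau> r \<omega>), (\<lambda>r\<in>I. K r \<omega>))"

text \<open>The value returned by the simulation, \<open>False\<close> standing for zero and \<open>True\<close> for one: only the
  event times in \<open>[0,T]\<close> are inspected, and any successful killing mark \<open>K r\<close> there returns zero;
  otherwise the final outcome \<open>H\<close> is returned.\<close>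

definition returned_value ::
    "('w \<Rightarrow> real) \<Rightarrow> (nat \<Rightarrow> 'w \<Rightarrow> real) \<Rightarrow> (nat \<Rightarrow> 'w \<Rightarrow> bool) \<Rightarrow> ('w \<Rightarrow> bool) \<Rightarrow> 'w \<Rightarrow> bool" where
  "returned_value T \<tau> K H \<omega> = (if \<exists>r. \<tau> r \<omega> \<le> T \<omega> \<and> K r \<omega> then False else H \<omega>)"

definition feynman_kac ::
    "'w measure \<Rightarrow> (real \<Rightarrow> 'w \<Rightarrow> torus) \<Rightarrow> ('w \<Rightarrow> real) \<Rightarrow> real \<Rightarrow> (torus \<Rightarrow> real) \<Rightarrow> (torus \<Rightarrow> real) \<Rightarrow> real"
  where
  "feynman_kac M B T lam q h =
     prob_space.expectation M
       (\<lambda>\<omega>. exp (- (LINT t:{0..T \<omega>}|lborel. q (B t \<omega>))) * (h (B (T \<omega>) \<omega>) / lam))"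

end

theory Submission
  imports Defs
begin

text \<open>The returned value is one exactly when every inspected killing mark fails and the final draw
  succeeds. Its expectation is computed by averaging out the sources of randomness one after another.

  The coins go first. Given everything drawn before it, each coin is Bernoulli, and so it may be
  replaced in an expectation by its success probability; this is
  \<open>bernoulli_given_expectation\<close>, applied once to the final draw and then, in
  \<open>expectation_replace_marks\<close>, to the killing marks from the last to the first. What remains is the
  expectation of
  \<open>\<Prod>r. (1 - of_bool (\<tau> r \<le> T) * q (B (\<tau> r)) / q_max) * h (B T) / lam\<close>,
  where only finitely many factors differ from one because the event times tend to infinity.

  The event times go next. They are independent of the path and the clock, so these may be held fixed
  (\<open>expectation_freeze\<close>), and the Poisson process has the product functional
  \<open>E (\<Prod>r. 1 - g (\<tau> r)) = exp (- (q_max * \<integral> g))\<close> for functions \<open>g\<close> of bounded support with values in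
  the unit interval (\<open>poisson_product_functional\<close>): for a step function it is a product of
  generating functions of independent Poisson counts, and step functions approximate the rest.
  With \<open>g\<close> equal to \<open>q / q_max\<close> along the path up to time \<open>T\<close>, the rate cancels and leaves the
  exponential of minus the integral of \<open>q\<close>. The remaining average over the path and the clock is
  \<open>u(s)\<close>.

  One point needs care: the position of the path at a random time has to be measurable with respect
  to the history, although evaluation at a variable time is not measurable on the product space of
  all paths. Continuity of the Brownian paths supplies this
  (\<open>measurable_at_random_time\<close>), once limits of Borel maps into the torus are known to be Borel
  (\<open>borel_measurable_torus_LIMSEQ\<close>).\<close>

section \<open>Borel maps into the torus\<close>

text \<open>The torus is only given as a topological quotient; the unit circle in the complex plane
  provides a metric model for its Borel sets.\<close>

lift_definition circle_cis :: "circle \<Rightarrow> complex" is "\<lambda>x. cis (2 * pi * x)"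
proof -
  fix x y :: real
  assume "x - y \<in> \<int>"
  then have "cis (2 * pi * (x - y)) = 1" by (rule cis_multiple_2pi)
  then show "cis (2 * pi * x) = cis (2 * pi * y)"
    by (simp add: right_diff_distrib flip: cis_divide)
qed

lemma inj_circle_cis: "inj circle_cis"
proof (rule injI, transfer)
  fix x y :: real
  assume "cis (2 * pi * x) = cis (2 * pi * y)"
  then have "sin (2 * pi * x) = sin (2 * pi * y) \<and> cos (2 * pi * x) = cos (2 * pi * y)"
    by (simp add: complex_eq_iff)
  then obtain n :: int where "2 * pi * x = 2 * pi * y + 2 * pi * n"
    unfolding sin_cos_eq_iff by blast
  then have "2 * pi * (x - y) = 2 * pi * n" by (simp add: algebra_simps)
  then have "x - y = n" by simp
  then show "x - y \<in> \<int>" by simp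
qed

lemma continuous_on_circle_cis: "continuous_on UNIV circle_cis"
proof -
  have "open (circle_cis -` U)" if "open U" for U
  proof -
    have "to_circle -` circle_cis -` U = (\<lambda>x. cis (2 * pi * x)) -` U"
      by (auto simp: circle_cis.abs_eq)
    moreover have "open ((\<lambda>x :: real. cis (2 * pi * x)) -` U)"
      using that by (intro open_vimage continuous_intros)
    ultimately show ?thesis by (simp add: open_circle_def)
  qed
  then show ?thesis by (simp add: continuous_on_open_vimage)
qed

lemma compact_circle: "compact (UNIV :: circle set)"
proof -
  have cont: "continuous_on UNIV to_circle"
    by (simp add: continuous_on_open_vimage open_circle_def)
  have "x \<in> to_circle ` {0..1}" for x
  proof -
    obtain y where y: "x = to_circle y" by (metis Quotient_circle Quotient_abs_rep)
    have "y - frac y \<in> \<int>" by (simp add: frac_def)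
    then have "x = to_circle (frac y)" by (simp add: y circle.abs_eq_iff)
    moreover have "frac y \<in> {0..1}" using frac_lt_1[of y] by (simp add: frac_ge_0 less_imp_le)
    ultimately show ?thesis by blast
  qed
  then have "UNIV = to_circle ` {0..1}" by blast
  then show ?thesis
    using compact_continuous_image[OF continuous_on_subset[OF cont subset_UNIV] compact_Icc[of 0 1]]
    by simp
qed

text \<open>A continuous injection of a compact space into a metric space maps closed sets to closed sets,
  so the Borel sets upstairs are preimages of Borel sets downstairs, where limits are known to
  preserve measurability.\<close>

lemma borel_measurable_LIMSEQ_embedding:
  fixes e :: "'a::topological_space \<Rightarrow> 'b::metric_space" and f :: "nat \<Rightarrow> 'c \<Rightarrow> 'a"
  assumes "compact (UNIV :: 'a set)" and cont: "continuous_on UNIV e" and "inj e"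
    and f: "\<And>i. f i \<in> borel_measurable N"
    and lim: "\<And>x. x \<in> space N \<Longrightarrow> (\<lambda>i. f i x) \<longlonglongrightarrow> g x"
  shows "g \<in> borel_measurable N"
proof (rule borel_measurableI)
  fix S :: "'a set"
  assume S: "open S"
  have "e \<in> borel_measurable borel"
    using cont by (rule borel_measurable_continuous_onI)
  then have "(\<lambda>x. e (f i x)) \<in> borel_measurable N" for i
    by (rule measurable_compose[OF f])
  moreover have "(\<lambda>i. e (f i x)) \<longlonglongrightarrow> e (g x)" if "x \<in> space N" for x
    using continuous_on_tendsto_compose[OF cont lim[OF that]] by simp
  ultimately have eg: "(\<lambda>x. e (g x)) \<in> borel_measurable N"
    by (rule borel_measurable_LIMSEQ_metric)
  have "compact (UNIV \<inter> - S)"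
    using assms(1) S by (intro compact_Int_closed) auto
  then have "compact (e ` (- S))"
    by (intro compact_continuous_image continuous_on_subset[OF cont]) auto
  then have "open (- (e ` (- S)))"
    by (intro open_Compl compact_imp_closed)
  then have "(\<lambda>x. e (g x)) -` (- (e ` (- S))) \<inter> space N \<in> sets N"
    by (intro measurable_sets[OF eg]) auto
  also have "(\<lambda>x. e (g x)) -` (- (e ` (- S))) \<inter> space N = g -` S \<inter> space N"
    using \<open>inj e\<close> by (auto dest: injD)
  finally show "g -` S \<inter> space N \<in> sets N" .
qed

lemma borel_measurable_torus_LIMSEQ:
  fixes f :: "nat \<Rightarrow> 'a \<Rightarrow> torus"
  assumes "\<And>i. f i \<in> borel_measurable N" "\<And>x. x \<in> space N \<Longrightarrow> (\<lambda>i. f i x) \<longlonglongrightarrow> g x"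
  shows "g \<in> borel_measurable N"
proof (rule borel_measurable_LIMSEQ_embedding[OF _ _ _ assms])
  show "compact (UNIV :: torus set)"
    using compact_Times[OF compact_circle compact_circle] by simp
  show "continuous_on UNIV (map_prod circle_cis circle_cis)"
    unfolding map_prod_def case_prod_unfold
    by (intro continuous_intros continuous_on_compose2[OF continuous_on_circle_cis]) auto
  show "inj (map_prod circle_cis circle_cis)"
    using inj_circle_cis by (simp add: prod.inj_map)
qed

lemma tendsto_rounding_down:
  fixes x :: real
  assumes "0 \<le> x"
  shows "(\<lambda>n. real (nat \<lfloor>x * Suc n\<rfloor>) / Suc n) \<longlonglongrightarrow> x"
proof -
  have bound: "\<bar>real (nat \<lfloor>x * Suc n\<rfloor>) / Suc n - x\<bar> \<le> 1 / Suc n" for n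
  proof -
    have "real (nat \<lfloor>x * Suc n\<rfloor>) / Suc n - x = (real (nat \<lfloor>x * Suc n\<rfloor>) - x * Suc n) / Suc n"
      by (simp add: field_simps del: of_nat_Suc)
    moreover have "\<bar>real (nat \<lfloor>x * Suc n\<rfloor>) - x * Suc n\<bar> \<le> 1"
      using assms by (simp add: of_nat_nat del: of_nat_Suc) linarith
    ultimately show ?thesis by (simp add: abs_divide divide_right_mono del: of_nat_Suc)
  qed
  have "(\<lambda>n. 1 / real (Suc n)) \<longlonglongrightarrow> 0"
    using LIMSEQ_inverse_real_of_nat by (simp add: inverse_eq_divide)
  then have "(\<lambda>n. real (nat \<lfloor>x * Suc n\<rfloor>) / Suc n - x) \<longlonglongrightarrow> 0"
    by (rule Lim_null_comparison[rotated]) (use bound in auto)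
  then show ?thesis by (simp add: LIM_zero_iff)
qed

text \<open>The cylinder sets of the path space say nothing about a path at a random time. Continuity
  repairs this: rounding the time down to the grid of mesh \<open>1 / (n + 1)\<close> leaves countably many
  deterministic times, and the rounded positions converge.\<close>

lemma measurable_at_random_time:
  fixes X :: "real \<Rightarrow> 'a \<Rightarrow> torus"
  assumes X: "\<And>t. 0 \<le> t \<Longrightarrow> X t \<in> borel_measurable N"
    and cont: "\<And>x. x \<in> space N \<Longrightarrow> continuous_on {0..} (\<lambda>t. X t x)"
    and \<rho>[measurable]: "\<rho> \<in> borel_measurable N" and nonneg: "\<And>x. x \<in> space N \<Longrightarrow> 0 \<le> \<rho> x"
  shows "(\<lambda>x. X (\<rho> x) x) \<in> borel_measurable N"
proof (rule borel_measurable_torus_LIMSEQ)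
  define \<rho>' where "\<rho>' n x = real (nat \<lfloor>\<rho> x * Suc n\<rfloor>) / Suc n" for n x
  show "(\<lambda>x. X (\<rho>' n x) x) \<in> borel_measurable N" for n
    unfolding \<rho>'_def
    by (rule measurable_compose_countable[where f = "\<lambda>k. X (real k / Suc n)"]) (auto intro: X)
  show "(\<lambda>n. X (\<rho>' n x) x) \<longlonglongrightarrow> X (\<rho> x) x" if x: "x \<in> space N" for x
    using nonneg[OF x] tendsto_rounding_down[OF nonneg[OF x]]
    by (intro continuous_on_tendsto_compose[OF cont[OF x]]) (auto simp: \<rho>'_def)
qed

section \<open>The probability that thinned Poisson points leave no mark\<close>

lemma (in prob_space) expectation_power_poisson:
  fixes N :: "'a \<Rightarrow> nat"
  assumes N[measurable]: "N \<in> measurable M (count_space UNIV)"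
    and prob: "\<And>k. prob {\<omega> \<in> space M. N \<omega> = k} = \<mu> ^ k / fact k * exp (- \<mu>)"
    and "0 \<le> \<mu>" "0 \<le> c"
  shows "expectation (\<lambda>\<omega>. c ^ N \<omega>) = exp (- ((1 - c) * \<mu>))"
proof -
  define w where "w k = \<mu> ^ k / fact k * exp (- \<mu>)" for k
  have "distr M (count_space UNIV) N = density (count_space UNIV) (\<lambda>k. ennreal (w k))"
  proof (rule measure_eqI_countable[of _ UNIV])
    fix k :: nat
    have "emeasure (distr M (count_space UNIV) N) {k} = emeasure M {\<omega> \<in> space M. N \<omega> = k}"
      by (subst emeasure_distr) (auto intro!: arg_cong[where f = "emeasure M"])
    also have "\<dots> = ennreal (w k)"
      using prob by (simp add: emeasure_eq_measure w_def)
    also have "\<dots> = emeasure (density (count_space UNIV) (\<lambda>k. ennreal (w k))) {k}"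
      by (simp add: emeasure_density nn_integral_count_space_indicator[symmetric]
          nn_integral_count_space_finite)
    finally show "emeasure (distr M (count_space UNIV) N) {k} =
      emeasure (density (count_space UNIV) (\<lambda>k. ennreal (w k))) {k}" .
  qed auto
  then have "expectation (\<lambda>\<omega>. c ^ N \<omega>) =
      integral\<^sup>L (density (count_space UNIV) (\<lambda>k. ennreal (w k))) (\<lambda>k. c ^ k)"
    by (subst integral_distr[OF N, symmetric]) auto
  also have "\<dots> = integral\<^sup>L (count_space UNIV) (\<lambda>k. w k * c ^ k)"
    using assms by (subst integral_density) (auto simp: w_def)
  also have "\<dots> = exp (- ((1 - c) * \<mu>))"
  proof -
    have "(\<lambda>k. (c * \<mu>) ^ k /\<^sub>R fact k * exp (- \<mu>)) sums (exp (c * \<mu>) * exp (- \<mu>))"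
      by (intro sums_mult2 exp_converges)
    also have "(\<lambda>k. (c * \<mu>) ^ k /\<^sub>R fact k * exp (- \<mu>)) = (\<lambda>k. w k * c ^ k)"
      by (auto simp: w_def power_mult_distrib field_simps)
    finally have s: "(\<lambda>k. w k * c ^ k) sums exp (- ((1 - c) * \<mu>))"
      by (simp add: algebra_simps flip: exp_add)
    then have "integrable (count_space UNIV) (\<lambda>k. w k * c ^ k)"
      using assms by (auto simp: integrable_count_space_nat_iff w_def sums_iff)
    then show ?thesis
      using s by (simp add: integral_count_space_nat sums_iff)
  qed
  finally show ?thesis .
qed

lemma poisson_times:
  assumes "homogeneous_poisson_process M rate \<tau>" "\<omega> \<in> space M"
  shows "0 \<le> \<tau> r \<omega>" and "finite {r. \<tau> r \<omega> \<le> t}"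
    and "\<forall>\<^sub>F n in sequentially. {r. \<tau> r \<omega> \<le> t} \<subseteq> {..<n}"
proof -
  have 1: "0 \<le> \<tau> 0 \<omega>" and 2: "strict_mono (\<lambda>r. \<tau> r \<omega>)"
    and 3: "filterlim (\<lambda>r. \<tau> r \<omega>) at_top sequentially"
    using assms unfolding homogeneous_poisson_process_def by auto
  show "0 \<le> \<tau> r \<omega>"
    using 1 strict_mono_leD[OF 2, of 0 r] by simp
  have "\<forall>\<^sub>F r in sequentially. t < \<tau> r \<omega>"
    using 3 by (simp add: filterlim_at_top_dense)
  then obtain n where n: "\<And>r. n \<le> r \<Longrightarrow> t < \<tau> r \<omega>"
    unfolding eventually_sequentially by blast
  then have sub: "{r. \<tau> r \<omega> \<le> t} \<subseteq> {..<n}"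
    by (metis (mono_tags, lifting) lessThan_iff linorder_not_less mem_Collect_eq subsetI)
  show "finite {r. \<tau> r \<omega> \<le> t}"
    using sub by (rule finite_subset) simp
  show "\<forall>\<^sub>F n in sequentially. {r. \<tau> r \<omega> \<le> t} \<subseteq> {..<n}"
    unfolding eventually_sequentially
    by (intro exI[of _ n] allI impI order_trans[OF sub]) simp
qed

lemma (in prob_space) poisson_counts_power_product:
  fixes A :: "nat \<Rightarrow> real set"
  assumes poisson: "homogeneous_poisson_process M rate \<tau>" and "0 \<le> rate"
    and A: "\<And>k. A k \<in> sets borel" "\<And>k. bounded (A k)" "\<And>k. A k \<subseteq> {0..}" "disjoint_family A"
    and c: "\<And>k. k \<in> I \<Longrightarrow> 0 \<le> c k" "\<And>k. k \<in> I \<Longrightarrow> c k \<le> 1" and "finite I"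
  shows "expectation (\<lambda>\<omega>. \<Prod>k\<in>I. (1 - c k) ^ num_points \<tau> (A k) \<omega>) =
    exp (- (rate * (\<Sum>k\<in>I. c k * measure lborel (A k))))"
proof (cases "I = {}")
  case True
  then show ?thesis by (simp add: prob_space)
next
  case False
  note laws = poisson[unfolded homogeneous_poisson_process_def, THEN conjunct2, THEN conjunct2]
  have indep: "indep_vars (\<lambda>_. count_space UNIV) (\<lambda>k. num_points \<tau> (A k)) UNIV"
    by (rule laws[THEN conjunct2, rule_format]) (use A in auto)
  have rv: "num_points \<tau> (A k) \<in> measurable M (count_space UNIV)" for k
    using indep unfolding indep_vars_def by auto
  have "measure M {\<omega> \<in> space M. num_points \<tau> (A k) \<omega> = j} =
      (rate * measure lborel (A k)) ^ j / fact j * exp (- (rate * measure lborel (A k)))" for k j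
    by (rule laws[THEN conjunct1, rule_format]) (use A in auto)
  then have pgf: "expectation (\<lambda>\<omega>. (1 - c k) ^ num_points \<tau> (A k) \<omega>) =
      exp (- (c k * (rate * measure lborel (A k))))" if "k \<in> I" for k
    using expectation_power_poisson[of "num_points \<tau> (A k)" "rate * measure lborel (A k)" "1 - c k"]
      rv[of k] c[OF that] \<open>0 \<le> rate\<close> by simp
  have int: "integrable M (\<lambda>\<omega>. (1 - c k) ^ num_points \<tau> (A k) \<omega>)" if "k \<in> I" for k
  proof (rule integrable_const_bound[where B = 1])
    show "(\<lambda>\<omega>. (1 - c k) ^ num_points \<tau> (A k) \<omega>) \<in> borel_measurable M"
      by (rule measurable_compose[OF rv]) auto
  qed (use c[OF that] in \<open>auto simp: power_abs power_le_one\<close>)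
  have "indep_vars (\<lambda>_. borel) (\<lambda>k \<omega>. (1 - c k) ^ num_points \<tau> (A k) \<omega>) I"
    by (rule indep_vars_compose2[OF indep_vars_subset[OF indep], where I = I]) auto
  then have "expectation (\<lambda>\<omega>. \<Prod>k\<in>I. (1 - c k) ^ num_points \<tau> (A k) \<omega>) =
      (\<Prod>k\<in>I. expectation (\<lambda>\<omega>. (1 - c k) ^ num_points \<tau> (A k) \<omega>))"
    using \<open>finite I\<close> int by (intro indep_vars_lebesgue_integral) auto
  also have "\<dots> = exp (- (rate * (\<Sum>k\<in>I. c k * measure lborel (A k))))"
    using \<open>finite I\<close> by (simp add: pgf exp_sum[symmetric] sum_negf sum_distrib_left algebra_simps)
  finally show ?thesis .
qed

text \<open>For a step function the product groups into powers of independent Poisson counts. A general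
  \<open>g\<close> is rounded down to multiples of \<open>1 / (m + 1)\<close>. Only finitely many points lie in the bounded support,
  so the products converge pointwise, and dominated convergence applies on both sides.\<close>

lemma (in prob_space) poisson_product_functional:
  assumes poisson: "homogeneous_poisson_process M rate \<tau>" and "0 \<le> rate"
    and g[measurable]: "g \<in> borel_measurable borel"
    and g01: "\<And>x. 0 \<le> g x" "\<And>x. g x \<le> 1"
    and supp: "\<And>x. x \<notin> {0..t} \<Longrightarrow> g x = 0"
  shows "expectation (\<lambda>\<omega>. \<Prod>r | \<tau> r \<omega> \<le> t. 1 - g (\<tau> r \<omega>)) = exp (- (rate * (\<integral>x. g x \<partial>lborel)))"
    and "(\<lambda>\<omega>. \<Prod>r | \<tau> r \<omega> \<le> t. 1 - g (\<tau> r \<omega>)) \<in> borel_measurable M"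
proof -
  have \<tau>[measurable]: "\<tau> r \<in> borel_measurable M" for r
    using poisson unfolding homogeneous_poisson_process_def by blast
  define \<kappa> where "\<kappa> m x = nat \<lfloor>g x * Suc m\<rfloor>" for m x
  define g' where "g' m x = real (\<kappa> m x) / Suc m" for m x
  define A where "A m k = {x \<in> {0..t}. \<kappa> m x = k}" for m k
  have \<kappa>[measurable]: "\<kappa> m \<in> measurable borel (count_space UNIV)" for m
    unfolding \<kappa>_def by measurable
  have g'[measurable]: "g' m \<in> borel_measurable borel" for m
    unfolding g'_def by measurable
  have A_meas[measurable]: "A m k \<in> sets borel" for m k
    unfolding A_def by measurable
  have \<kappa>_le: "\<kappa> m x \<le> Suc m" for m x
  proof -
    have "g x * Suc m \<le> real (Suc m)"
      by (rule mult_left_le_one_le) (use g01 in auto)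
    then have "\<lfloor>g x * Suc m\<rfloor> \<le> int (Suc m)" by linarith
    then show ?thesis unfolding \<kappa>_def by linarith
  qed
  have g'01: "0 \<le> g' m x" "g' m x \<le> 1" for m x
    using \<kappa>_le[of m x] by (auto simp: g'_def simp del: of_nat_Suc)
  have g'_supp: "g' m x = 0" if "x \<notin> {0..t}" for m x
    using supp[OF that] by (simp add: g'_def \<kappa>_def)
  have g'_lim: "(\<lambda>m. g' m x) \<longlonglongrightarrow> g x" for x
    using tendsto_rounding_down[OF g01(1)[of x]] by (simp add: g'_def \<kappa>_def)
  define P where "P \<phi> \<omega> = (\<Prod>r | \<tau> r \<omega> \<le> t. 1 - \<phi> (\<tau> r \<omega>))" for \<phi> :: "real \<Rightarrow> real" and \<omega>
  have P_meas: "P \<phi> \<in> borel_measurable M" if [measurable]: "\<phi> \<in> borel_measurable borel" for \<phi>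
  proof (rule borel_measurable_LIMSEQ_metric)
    show "(\<lambda>\<omega>. \<Prod>r<n. if \<tau> r \<omega> \<le> t then 1 - \<phi> (\<tau> r \<omega>) else 1) \<in> borel_measurable M" for n
      by measurable
    show "(\<lambda>n. \<Prod>r<n. if \<tau> r \<omega> \<le> t then 1 - \<phi> (\<tau> r \<omega>) else 1) \<longlonglongrightarrow> P \<phi> \<omega>" if "\<omega> \<in> space M" for \<omega>
    proof (rule tendsto_eventually)
      show "\<forall>\<^sub>F n in sequentially. (\<Prod>r<n. if \<tau> r \<omega> \<le> t then 1 - \<phi> (\<tau> r \<omega>) else 1) = P \<phi> \<omega>"
        using poisson_times(3)[OF poisson that, of t]
      proof eventually_elim
        case (elim n)
        have "(\<Prod>r<n. if \<tau> r \<omega> \<le> t then 1 - \<phi> (\<tau> r \<omega>) else 1) =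
            (\<Prod>r\<in>{r. \<tau> r \<omega> \<le> t}. if \<tau> r \<omega> \<le> t then 1 - \<phi> (\<tau> r \<omega>) else 1)"
          using elim by (intro prod.mono_neutral_right) auto
        then show ?case by (simp add: P_def)
      qed
    qed
  qed
  have P01: "norm (P (g' m) \<omega>) \<le> 1" for m \<omega>
    unfolding P_def prod_norm[symmetric] by (intro prod_le_1) (use g'01 in auto)
  have "(\<lambda>m. expectation (P (g' m))) \<longlonglongrightarrow> expectation (P g)"
  proof (rule integral_dominated_convergence[where w = "\<lambda>_. 1"])
    show "AE \<omega> in M. (\<lambda>m. P (g' m) \<omega>) \<longlonglongrightarrow> P g \<omega>"
      unfolding P_def by (intro AE_I2 tendsto_prod tendsto_diff tendsto_const g'_lim)
  qed (use P_meas P01 in auto)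
  moreover have "expectation (P (g' m)) = exp (- (rate * (\<integral>x. g' m x \<partial>lborel)))" for m
  proof -
    have "P (g' m) \<omega> = (\<Prod>k\<le>Suc m. (1 - real k / Suc m) ^ num_points \<tau> (A m k) \<omega>)"
      if \<omega>: "\<omega> \<in> space M" for \<omega>
    proof -
      have set: "{r \<in> {r. \<tau> r \<omega> \<le> t}. \<kappa> m (\<tau> r \<omega>) = k} = {r. \<tau> r \<omega> \<in> A m k}" for k
        using poisson_times(1)[OF poisson \<omega>] by (auto simp: A_def)
      have "P (g' m) \<omega> = (\<Prod>k\<le>Suc m. \<Prod>r\<in>{r \<in> {r. \<tau> r \<omega> \<le> t}. \<kappa> m (\<tau> r \<omega>) = k}. 1 - g' m (\<tau> r \<omega>))"
        unfolding P_def using poisson_times(2)[OF poisson \<omega>] \<kappa>_le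
        by (intro prod.group[symmetric]) auto
      also have "\<dots> = (\<Prod>k\<le>Suc m. (1 - real k / Suc m) ^ num_points \<tau> (A m k) \<omega>)"
      proof (rule prod.cong[OF refl])
        fix k
        have "(\<Prod>r\<in>{r \<in> {r. \<tau> r \<omega> \<le> t}. \<kappa> m (\<tau> r \<omega>) = k}. 1 - g' m (\<tau> r \<omega>)) =
          (\<Prod>r\<in>{r \<in> {r. \<tau> r \<omega> \<le> t}. \<kappa> m (\<tau> r \<omega>) = k}. 1 - real k / Suc m)"
          by (intro prod.cong) (auto simp: g'_def)
        then show "(\<Prod>r\<in>{r \<in> {r. \<tau> r \<omega> \<le> t}. \<kappa> m (\<tau> r \<omega>) = k}. 1 - g' m (\<tau> r \<omega>)) =
          (1 - real k / Suc m) ^ num_points \<tau> (A m k) \<omega>"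
          unfolding set num_points_def by simp
      qed
      finally show ?thesis .
    qed
    then have "expectation (P (g' m)) =
        expectation (\<lambda>\<omega>. \<Prod>k\<le>Suc m. (1 - real k / Suc m) ^ num_points \<tau> (A m k) \<omega>)"
      by (intro Bochner_Integration.integral_cong) auto
    also have "\<dots> = exp (- (rate * (\<Sum>k\<le>Suc m. real k / Suc m * measure lborel (A m k))))"
    proof (rule poisson_counts_power_product[OF poisson \<open>0 \<le> rate\<close> A_meas])
      show "bounded (A m k)" for k
        by (rule bounded_subset[of "{0..t}"]) (auto simp: A_def)
    qed (auto simp: A_def disjoint_family_on_def simp del: of_nat_Suc)
    also have "(\<Sum>k\<le>Suc m. real k / Suc m * measure lborel (A m k)) = (\<integral>x. g' m x \<partial>lborel)"
    proof -
      have fin: "emeasure lborel (A m k) < \<infinity>" for k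
        by (rule le_less_trans[OF emeasure_mono[of _ "{0..t}"]])
          (auto simp: A_def emeasure_lborel_Icc_eq)
      have "g' m x = (\<Sum>k\<le>Suc m. real k / Suc m * indicator (A m k) x)" for x
      proof (cases "x \<in> {0..t}")
        case True
        then have "(\<Sum>k\<le>Suc m. real k / Suc m * indicator (A m k) x) =
            (\<Sum>k\<in>{\<kappa> m x}. real k / Suc m * indicator (A m k) x)"
          using \<kappa>_le[of m x] by (intro sum.mono_neutral_right) (auto simp: A_def)
        then show ?thesis using True by (simp add: A_def g'_def)
      next
        case False
        then show ?thesis using g'_supp[OF False] by (auto simp: A_def intro!: sum.neutral[symmetric])
      qed
      then have "(\<integral>x. g' m x \<partial>lborel) =
          (\<integral>x. (\<Sum>k\<le>Suc m. real k / Suc m * indicator (A m k) x) \<partial>lborel)"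
        by simp
      also have "\<dots> = (\<Sum>k\<le>Suc m. real k / Suc m * measure lborel (A m k))"
        using fin by (subst Bochner_Integration.integral_sum) (auto simp del: of_nat_Suc)
      finally show ?thesis by simp
    qed
    finally show ?thesis .
  qed
  moreover have "(\<lambda>m. exp (- (rate * (\<integral>x. g' m x \<partial>lborel)))) \<longlonglongrightarrow> exp (- (rate * (\<integral>x. g x \<partial>lborel)))"
  proof (intro tendsto_exp tendsto_minus tendsto_mult tendsto_const)
    show "(\<lambda>m. \<integral>x. g' m x \<partial>lborel) \<longlonglongrightarrow> (\<integral>x. g x \<partial>lborel)"
    proof (rule integral_dominated_convergence[where w = "indicator {0..t}"])
      show "integrable lborel (indicator {0..t} :: real \<Rightarrow> real)"
        by (rule integrable_real_indicator) (auto simp: emeasure_lborel_Icc_eq)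
      show "AE x in lborel. norm (g' m x) \<le> indicator {0..t} x" for m
        using g'01 g'_supp[of _ m] by (intro AE_I2) (auto simp: indicator_def)
    qed (use g'_lim in auto)
  qed
  ultimately show "expectation (\<lambda>\<omega>. \<Prod>r | \<tau> r \<omega> \<le> t. 1 - g (\<tau> r \<omega>)) =
      exp (- (rate * (\<integral>x. g x \<partial>lborel)))"
    unfolding P_def[symmetric] using LIMSEQ_unique by auto
  show "(\<lambda>\<omega>. \<Prod>r | \<tau> r \<omega> \<le> t. 1 - g (\<tau> r \<omega>)) \<in> borel_measurable M"
    using P_meas[OF g] by (simp add: P_def[abs_def])
qed

section \<open>Averaging out independent randomness and Bernoulli marks\<close>

text \<open>Independence makes the joint law of the outcome itself, seen through the information in \<open>X\<close>,
  and of \<open>Y\<close> a product measure, so Fubini integrates \<open>Y\<close> out with the outcome held fixed. Keeping the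
  outcome rather than \<open>X \<omega>\<close> as the first argument is what allows \<open>\<Phi>\<close> to use the continuity of the
  Brownian path: \<open>\<Phi>\<close> need not extend measurably to all functions in the path space.\<close>

lemma (in prob_space) expectation_freeze:
  fixes \<Phi> :: "'a \<times> 'c \<Rightarrow> real"
  assumes indep: "indep_pair M N X L Y"
    and \<Phi>: "\<Phi> \<in> borel_measurable (vimage_algebra (space M) X N \<Otimes>\<^sub>M L)"
    and bound: "\<And>x. norm (\<Phi> x) \<le> c"
  shows "expectation (\<lambda>\<omega>. \<Phi> (\<omega>, Y \<omega>)) = expectation (\<lambda>\<omega>. expectation (\<lambda>\<omega>'. \<Phi> (\<omega>, Y \<omega>')))"
    and "(\<lambda>\<omega>. expectation (\<lambda>\<omega>'. \<Phi> (\<omega>, Y \<omega>'))) \<in> borel_measurable M"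
proof -
  define F where "F = vimage_algebra (space M) X N"
  have X: "X \<in> measurable M N" and Y[measurable]: "Y \<in> measurable M L"
    and ind: "indep_set {X -` A \<inter> space M | A. A \<in> sets N} {Y -` A \<inter> space M | A. A \<in> sets L}"
    using indep unfolding indep_pair_def by auto
  have sets_F: "sets F = {X -` A \<inter> space M | A. A \<in> sets N}"
    unfolding F_def using measurable_space[OF X] by (intro sets_vimage_algebra2) auto
  have space_F: "space F = space M" by (simp add: F_def)
  have id[measurable]: "(\<lambda>\<omega>. \<omega>) \<in> measurable M F"
    using X by (auto simp: measurable_def space_F sets_F)
  define M1 where "M1 = distr M F (\<lambda>\<omega>. \<omega>)"
  define M2 where "M2 = distr M L Y"
  have [measurable_cong]: "sets M1 = sets F" "sets M2 = sets L" by (simp_all add: M1_def M2_def)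
  interpret M1: prob_space M1 unfolding M1_def by (rule prob_space_distr) measurable
  interpret M2: prob_space M2 unfolding M2_def by (rule prob_space_distr) measurable
  interpret P: pair_prob_space M1 M2 ..
  have joint: "M1 \<Otimes>\<^sub>M M2 = distr M (F \<Otimes>\<^sub>M L) (\<lambda>\<omega>. (\<omega>, Y \<omega>))"
  proof (rule pair_measure_eqI)
    show "sets (M1 \<Otimes>\<^sub>M M2) = sets (distr M (F \<Otimes>\<^sub>M L) (\<lambda>\<omega>. (\<omega>, Y \<omega>)))"
      by (simp add: M1_def M2_def cong: sets_pair_measure_cong)
    fix A C
    assume "A \<in> sets M1" "C \<in> sets M2"
    then have A: "A \<in> sets F" and C: "C \<in> sets L" by (auto simp: M1_def M2_def)
    have "A \<subseteq> space M" using sets.sets_into_space[OF A] by (simp add: space_F)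
    then have pre: "(\<lambda>\<omega>. (\<omega>, Y \<omega>)) -` (A \<times> C) \<inter> space M = A \<inter> (Y -` C \<inter> space M)"
      by auto
    have "prob (A \<inter> (Y -` C \<inter> space M)) = prob A * prob (Y -` C \<inter> space M)"
      using A C by (intro indep_setD[OF ind]) (auto simp: sets_F)
    then show "emeasure M1 A * emeasure M2 C =
        emeasure (distr M (F \<Otimes>\<^sub>M L) (\<lambda>\<omega>. (\<omega>, Y \<omega>))) (A \<times> C)"
      using A C unfolding M1_def M2_def
      by (simp add: emeasure_distr emeasure_eq_measure ennreal_mult pre Int_absorb2 \<open>A \<subseteq> space M\<close>)
  qed unfold_locales
  have \<Phi>'[measurable]: "\<Phi> \<in> borel_measurable (F \<Otimes>\<^sub>M L)" using \<Phi> by (simp add: F_def)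
  have "integrable (M1 \<Otimes>\<^sub>M M2) \<Phi>"
    by (rule P.integrable_const_bound[where B = c]) (use bound in auto)
  then have "(\<integral>x. (\<integral>y. \<Phi> (x, y) \<partial>M2) \<partial>M1) = integral\<^sup>L (M1 \<Otimes>\<^sub>M M2) \<Phi>"
    by (intro P.integral_fst') auto
  also have "\<dots> = expectation (\<lambda>\<omega>. \<Phi> (\<omega>, Y \<omega>))"
    unfolding joint by (intro integral_distr) auto
  finally have fub: "(\<integral>x. (\<integral>y. \<Phi> (x, y) \<partial>M2) \<partial>M1) = expectation (\<lambda>\<omega>. \<Phi> (\<omega>, Y \<omega>))" .
  have inner: "(\<integral>y. \<Phi> (\<omega>, y) \<partial>M2) = expectation (\<lambda>\<omega>'. \<Phi> (\<omega>, Y \<omega>'))" if "\<omega> \<in> space M" for \<omega>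
    unfolding M2_def
  proof (rule integral_distr[OF Y])
    show "(\<lambda>y. \<Phi> (\<omega>, y)) \<in> borel_measurable L"
      using that by (intro measurable_compose[OF measurable_Pair1' \<Phi>']) (simp add: space_F)
  qed
  have meas: "(\<lambda>x. \<integral>y. \<Phi> (x, y) \<partial>M2) \<in> borel_measurable F"
    by measurable
  have "expectation (\<lambda>\<omega>. \<Phi> (\<omega>, Y \<omega>)) = expectation (\<lambda>x. \<integral>y. \<Phi> (x, y) \<partial>M2)"
    unfolding fub[symmetric] M1_def using meas by (intro integral_distr id) auto
  also have "\<dots> = expectation (\<lambda>\<omega>. expectation (\<lambda>\<omega>'. \<Phi> (\<omega>, Y \<omega>')))"
    by (intro Bochner_Integration.integral_cong inner) auto
  finally show "expectation (\<lambda>\<omega>. \<Phi> (\<omega>, Y \<omega>)) = expectation (\<lambda>\<omega>. expectation (\<lambda>\<omega>'. \<Phi> (\<omega>, Y \<omega>')))" .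
  have "(\<lambda>x. \<integral>y. \<Phi> (x, y) \<partial>M2) \<in> borel_measurable M"
    by (rule measurable_compose[OF id meas])
  then show "(\<lambda>\<omega>. expectation (\<lambda>\<omega>'. \<Phi> (\<omega>, Y \<omega>'))) \<in> borel_measurable M"
    using inner by (subst measurable_cong[OF inner[symmetric]]) auto
qed

lemma (in prob_space) bernoulli_given_expectation:
  fixes Z :: "'a \<Rightarrow> real"
  assumes K: "bernoulli_given M N X p K"
    and Z: "Z \<in> borel_measurable (vimage_algebra (space M) X N)" and bound: "\<And>\<omega>. \<bar>Z \<omega>\<bar> \<le> c"
    and p: "p \<in> borel_measurable M"
  shows "expectation (\<lambda>\<omega>. Z \<omega> * of_bool (K \<omega>)) = expectation (\<lambda>\<omega>. Z \<omega> * p \<omega>)"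
proof -
  define F where "F = vimage_algebra (space M) X N"
  have X: "X \<in> measurable M N" and [measurable]: "K \<in> measurable M (count_space UNIV)"
    and ce: "AE \<omega> in M. real_cond_exp M F (\<lambda>\<omega>. of_bool (K \<omega>)) \<omega> = p \<omega>"
    using K unfolding bernoulli_given_def F_def by auto
  have sub: "subalgebra M F"
    unfolding subalgebra_def F_def using X measurable_space[OF X]
    by (auto simp: sets_vimage_algebra2 Pi_iff)
  interpret finite_measure_subalgebra M F by unfold_locales (rule sub)
  have ZF: "Z \<in> borel_measurable F" using Z by (simp add: F_def)
  have [measurable]: "Z \<in> borel_measurable M" by (rule measurable_from_subalg[OF sub ZF])
  have [measurable]: "real_cond_exp M F (\<lambda>\<omega>. of_bool (K \<omega>)) \<in> borel_measurable M"
    by simp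
  have K': "(\<lambda>\<omega>. of_bool (K \<omega>) :: real) \<in> borel_measurable M" by measurable
  have "integrable M (\<lambda>\<omega>. Z \<omega> * of_bool (K \<omega>))"
  proof (rule integrable_const_bound[where B = c])
    have "\<bar>Z \<omega>\<bar> * of_bool (K \<omega>) \<le> c" for \<omega>
      using bound[of \<omega>] by (cases "K \<omega>") auto
    then show "AE \<omega> in M. norm (Z \<omega> * of_bool (K \<omega>)) \<le> c"
      by (simp add: abs_mult)
  qed (use K' in measurable)
  then have "expectation (\<lambda>\<omega>. Z \<omega> * of_bool (K \<omega>)) =
      expectation (\<lambda>\<omega>. Z \<omega> * real_cond_exp M F (\<lambda>\<omega>. of_bool (K \<omega>)) \<omega>)"
    using real_cond_exp_intg(2)[OF _ ZF K'] by simp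
  also have "\<dots> = expectation (\<lambda>\<omega>. Z \<omega> * p \<omega>)"
    using ce p by (intro integral_cong_AE) auto
  finally show ?thesis .
qed

text \<open>The marks are replaced one at a time, the last one first: given the history before it, the
  last mark is a Bernoulli variable, and its factor turns into \<open>1 - a n * p n\<close>. That factor involves
  no mark at all, and so, being measurable at every stage, it can be absorbed into the weight \<open>Z\<close>
  before the next mark is treated. Here \<open>\<G> r\<close> is the information available when mark \<open>r\<close> is drawn,
  and \<open>a r\<close> says whether that mark is inspected.\<close>

lemma (in prob_space) expectation_replace_marks:
  fixes p a :: "nat \<Rightarrow> 'a \<Rightarrow> real"
  assumes K: "\<And>r. bernoulli_given M (N r) (X r) (p r) (K r)"
    and \<G>: "\<And>r. \<G> r = vimage_algebra (space M) (X r) (N r)"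
    and past: "\<And>i r. i < r \<Longrightarrow> K i \<in> measurable (\<G> r) (count_space UNIV)"
    and a: "\<And>i r. a i \<in> borel_measurable (\<G> r)" "\<And>i \<omega>. 0 \<le> a i \<omega>" "\<And>i \<omega>. a i \<omega> \<le> 1"
    and p: "\<And>i r. p i \<in> borel_measurable (\<G> r)" "\<And>i \<omega>. 0 \<le> p i \<omega>" "\<And>i \<omega>. p i \<omega> \<le> 1"
    and Z: "\<And>r. Z \<in> borel_measurable (\<G> r)" "\<And>\<omega>. 0 \<le> Z \<omega>" "\<And>\<omega>. Z \<omega> \<le> 1"
  shows "expectation (\<lambda>\<omega>. (\<Prod>r<n. 1 - a r \<omega> * of_bool (K r \<omega>)) * Z \<omega>) =
    expectation (\<lambda>\<omega>. (\<Prod>r<n. 1 - a r \<omega> * p r \<omega>) * Z \<omega>)"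
  using Z
proof (induction n arbitrary: Z)
  case 0
  then show ?case by simp
next
  case (Suc n)
  have sub: "subalgebra M (\<G> r)" for r
  proof -
    have "X r \<in> measurable M (N r)" using K unfolding bernoulli_given_def by blast
    then show ?thesis
      unfolding subalgebra_def \<G> using measurable_space[of "X r" M "N r"]
      by (auto simp: sets_vimage_algebra2 Pi_iff)
  qed
  note toM = measurable_from_subalg[OF sub]
  have [measurable]: "K r \<in> measurable M (count_space UNIV)" for r
    using K unfolding bernoulli_given_def by blast
  have [measurable]: "a r \<in> borel_measurable M" "p r \<in> borel_measurable M" "Z \<in> borel_measurable M" for r
    using a(1) p(1) Suc.prems(1) by (auto intro: toM)
  define Q where "Q \<omega> = (\<Prod>r<n. 1 - a r \<omega> * of_bool (K r \<omega>))" for \<omega>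
  have Q01: "0 \<le> Q \<omega>" "Q \<omega> \<le> 1" for \<omega>
    unfolding Q_def using a by (auto intro!: prod_nonneg prod_le_1)
  have QM[measurable]: "Q \<in> borel_measurable M"
    unfolding Q_def by measurable
  have QG: "Q \<in> borel_measurable (\<G> n)"
  proof -
    have "(\<lambda>\<omega>. of_bool (K i \<omega>) :: real) \<in> borel_measurable (\<G> n)" if "i < n" for i
      by (rule measurable_compose[OF past[OF that]]) simp
    then show ?thesis
      unfolding Q_def using a(1)
      by (intro borel_measurable_prod borel_measurable_diff borel_measurable_times) auto
  qed
  have pa01: "0 \<le> a n \<omega> * p n \<omega>" "a n \<omega> * p n \<omega> \<le> 1" for \<omega>
    using a p by (auto intro: mult_le_one)
  have ZQ01: "0 \<le> Z \<omega> * Q \<omega>" "Z \<omega> * Q \<omega> \<le> 1" for \<omega>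
    using Suc.prems(2,3) Q01 by (auto intro: mult_le_one)
  have W01: "0 \<le> Z \<omega> * Q \<omega> * a n \<omega>" "Z \<omega> * Q \<omega> * a n \<omega> \<le> 1" for \<omega>
    using ZQ01 a by (auto intro: mult_le_one)
  have WpQ: "\<bar>Z \<omega> * Q \<omega> * a n \<omega> * p n \<omega>\<bar> \<le> 1" for \<omega>
    using W01[of \<omega>] p by (simp add: mult_le_one)
  have int: "integrable M (\<lambda>\<omega>. Z \<omega> * Q \<omega>)"
    "integrable M (\<lambda>\<omega>. Z \<omega> * Q \<omega> * a n \<omega> * of_bool (K n \<omega>))"
    "integrable M (\<lambda>\<omega>. Z \<omega> * Q \<omega> * a n \<omega> * p n \<omega>)"
    using ZQ01 W01 WpQ by (auto intro!: integrable_const_bound[where B = 1] simp: of_bool_def)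
  have step: "expectation (\<lambda>\<omega>. Z \<omega> * Q \<omega> * a n \<omega> * of_bool (K n \<omega>)) =
      expectation (\<lambda>\<omega>. Z \<omega> * Q \<omega> * a n \<omega> * p n \<omega>)"
  proof (rule bernoulli_given_expectation[OF K])
    show "(\<lambda>\<omega>. Z \<omega> * Q \<omega> * a n \<omega>) \<in> borel_measurable (vimage_algebra (space M) (X n) (N n))"
      using QG a(1) Suc.prems(1) by (auto simp flip: \<G>)
  qed (use W01 in auto)
  have "expectation (\<lambda>\<omega>. (\<Prod>r<Suc n. 1 - a r \<omega> * of_bool (K r \<omega>)) * Z \<omega>) =
      expectation (\<lambda>\<omega>. Z \<omega> * Q \<omega> - Z \<omega> * Q \<omega> * a n \<omega> * of_bool (K n \<omega>))"
    by (simp add: Q_def algebra_simps)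
  also have "\<dots> = expectation (\<lambda>\<omega>. Z \<omega> * Q \<omega> - Z \<omega> * Q \<omega> * a n \<omega> * p n \<omega>)"
    using int step by simp
  also have "\<dots> = expectation (\<lambda>\<omega>. Q \<omega> * ((1 - a n \<omega> * p n \<omega>) * Z \<omega>))"
    by (simp add: algebra_simps)
  also have "\<dots> = expectation (\<lambda>\<omega>. (\<Prod>r<n. 1 - a r \<omega> * p r \<omega>) * ((1 - a n \<omega> * p n \<omega>) * Z \<omega>))"
    unfolding Q_def
  proof (rule Suc.IH)
    show "(\<lambda>\<omega>. (1 - a n \<omega> * p n \<omega>) * Z \<omega>) \<in> borel_measurable (\<G> r)" for r
      using a(1) p(1) Suc.prems(1) by measurable
  qed (use pa01 Suc.prems in \<open>auto intro: mult_le_one\<close>)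
  finally show ?case by (simp add: mult.assoc)
qed

section \<open>The simulation\<close>

text \<open>Given the Brownian path, the killing marks thin the Poisson process to rate \<open>q\<close> along the path.\<close>

lemma (in prob_space) no_kill_along_path:
  fixes w :: "real \<Rightarrow> torus" and q :: "torus \<Rightarrow> real"
  assumes poisson: "homogeneous_poisson_process M q_max \<tau>" and "0 < q_max"
    and w: "continuous_on {0..} w"
    and q: "q \<in> borel_measurable borel" "\<And>x. 0 \<le> q x \<and> q x \<le> q_max"
  shows "(\<lambda>n. expectation (\<lambda>\<omega>. \<Prod>r<n. 1 - of_bool (\<tau> r \<omega> \<le> t) * (q (w (\<tau> r \<omega>)) / q_max)))
    \<longlonglongrightarrow> exp (- (LINT x:{0..t}|lborel. q (w x)))"
proof -
  \<comment> \<open>Nothing is known about \<open>w\<close> at negative times; \<open>max 0 x\<close> makes \<open>g\<close> Borel on the whole line.\<close>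
  define g where "g x = indicator {0..t} x * (q (w (max 0 x)) / q_max)" for x
  have \<tau>[measurable]: "\<tau> r \<in> borel_measurable M" for r
    using poisson unfolding homogeneous_poisson_process_def by blast
  have "(\<lambda>x. w (max 0 x)) \<in> borel_measurable borel"
    by (rule measurable_at_random_time[where X = "\<lambda>t _. w t"]) (use w in auto)
  from measurable_compose[OF this q(1)]
  have [measurable]: "(\<lambda>x. q (w (max 0 x))) \<in> borel_measurable borel" .
  have g_meas[measurable]: "g \<in> borel_measurable borel" unfolding g_def by measurable
  have g01: "0 \<le> g x" "g x \<le> 1" for x
    using q(2) \<open>0 < q_max\<close> by (auto simp: g_def indicator_def)
  have g_supp: "g x = 0" if "x \<notin> {0..t}" for x
    using that by (simp add: g_def)
  note func = poisson_product_functional[OF poisson less_imp_le[OF \<open>0 < q_max\<close>] g_meas g01 g_supp]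
  have "(\<lambda>n. expectation (\<lambda>\<omega>. \<Prod>r<n. 1 - g (\<tau> r \<omega>)))
      \<longlonglongrightarrow> expectation (\<lambda>\<omega>. \<Prod>r | \<tau> r \<omega> \<le> t. 1 - g (\<tau> r \<omega>))"
  proof (rule integral_dominated_convergence[where w = "\<lambda>_. 1"])
    show "AE \<omega> in M. (\<lambda>n. \<Prod>r<n. 1 - g (\<tau> r \<omega>)) \<longlonglongrightarrow> (\<Prod>r | \<tau> r \<omega> \<le> t. 1 - g (\<tau> r \<omega>))"
    proof (intro AE_I2 tendsto_eventually)
      fix \<omega>
      assume "\<omega> \<in> space M"
      from poisson_times(3)[OF poisson this, of t]
      show "\<forall>\<^sub>F n in sequentially. (\<Prod>r<n. 1 - g (\<tau> r \<omega>)) = (\<Prod>r | \<tau> r \<omega> \<le> t. 1 - g (\<tau> r \<omega>))"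
      proof eventually_elim
        case (elim n)
        then show ?case
          by (intro prod.mono_neutral_right) (auto simp: g_supp)
      qed
    qed
    show "AE \<omega> in M. norm (\<Prod>r<n. 1 - g (\<tau> r \<omega>)) \<le> 1" for n
      unfolding prod_norm[symmetric] by (intro AE_I2 prod_le_1) (use g01 in auto)
  qed (use func(2) in auto)
  also have "expectation (\<lambda>\<omega>. \<Prod>r | \<tau> r \<omega> \<le> t. 1 - g (\<tau> r \<omega>)) =
      exp (- (LINT x:{0..t}|lborel. q (w x)))"
  proof -
    have "q_max * (\<integral>x. g x \<partial>lborel) = (\<integral>x. q_max * g x \<partial>lborel)"
      by simp
    also have "\<dots> = (LINT x:{0..t}|lborel. q (w x))"
      unfolding set_lebesgue_integral_def using \<open>0 < q_max\<close>
      by (intro Bochner_Integration.integral_cong) (auto simp: g_def indicator_def)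
    finally show ?thesis using func(1) by simp
  qed
  also have "(\<lambda>n. expectation (\<lambda>\<omega>. \<Prod>r<n. 1 - g (\<tau> r \<omega>))) =
      (\<lambda>n. expectation (\<lambda>\<omega>. \<Prod>r<n. 1 - of_bool (\<tau> r \<omega> \<le> t) * (q (w (\<tau> r \<omega>)) / q_max)))"
  proof -
    have "g (\<tau> r \<omega>) = of_bool (\<tau> r \<omega> \<le> t) * (q (w (\<tau> r \<omega>)) / q_max)" if "\<omega> \<in> space M" for r \<omega>
      using poisson_times(1)[OF poisson that, of r] by (simp add: g_def indicator_def max_def)
    then show ?thesis
      by (intro ext Bochner_Integration.integral_cong prod.cong refl) auto
  qed
  finally show ?thesis .
qed

text \<open>Measurability with respect to the \<open>\<sigma>\<close>-algebra generated by the history, not merely with respect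
  to \<open>M\<close>, is what \<open>bernoulli_given_expectation\<close> asks of its weight.\<close>

lemma history_components_measurable:
  assumes "history B T \<tau> K I \<in> measurable M (history_space I)"
  defines "F \<equiv> vimage_algebra (space M) (history B T \<tau> K I) (history_space I)"
  shows "0 \<le> t \<Longrightarrow> B t \<in> borel_measurable F"
    and "T \<in> borel_measurable F"
    and "\<tau> r \<in> borel_measurable F"
    and "i \<in> I \<Longrightarrow> K i \<in> measurable F (count_space UNIV)"
proof -
  have h: "history B T \<tau> K I \<in> measurable F (history_space I)"
    unfolding F_def using measurable_space[OF assms(1)] by (intro measurable_vimage_algebra1) auto
  have B: "(\<lambda>x. fst x t) \<in> borel_measurable (history_space I)" if "0 \<le> t" for t
    using that unfolding history_space_def path_space_def
    by (intro measurable_compose[OF measurable_fst measurable_component_singleton]) auto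
  show "B t \<in> borel_measurable F" if "0 \<le> t"
    using measurable_compose[OF h B[OF that]] that by (simp add: history_def sample_path_def)
  have "(\<lambda>x. fst (snd x)) \<in> borel_measurable (history_space I)"
    unfolding history_space_def by measurable
  from measurable_compose[OF h this] show "T \<in> borel_measurable F"
    by (simp add: history_def)
  have "(\<lambda>x. fst (snd (snd x)) r) \<in> borel_measurable (history_space I)"
    unfolding history_space_def by measurable
  from measurable_compose[OF h this] show "\<tau> r \<in> borel_measurable F"
    by (simp add: history_def)
  have K: "(\<lambda>x. snd (snd (snd x)) i) \<in> measurable (history_space I) (count_space UNIV)" if "i \<in> I" for i
    using that unfolding history_space_def by measurable
  show "K i \<in> measurable F (count_space UNIV)" if "i \<in> I"
    using measurable_compose[OF h K[OF that]] that by (simp add: history_def)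
qed

lemma path_clock_components_measurable:
  fixes T :: "'w \<Rightarrow> real"
  assumes "sample_path B \<in> measurable M path_space" "T \<in> borel_measurable M"
  defines "F \<equiv> vimage_algebra (space M) (\<lambda>\<omega>. (sample_path B \<omega>, T \<omega>)) (path_space \<Otimes>\<^sub>M borel)"
  shows "0 \<le> t \<Longrightarrow> B t \<in> borel_measurable F" and "T \<in> borel_measurable F"
proof -
  have h: "(\<lambda>\<omega>. (sample_path B \<omega>, T \<omega>)) \<in> measurable F (path_space \<Otimes>\<^sub>M borel)"
    unfolding F_def using measurable_space[OF assms(1)]
    by (intro measurable_vimage_algebra1) (auto simp: space_pair_measure)
  have B: "(\<lambda>x. fst x t) \<in> borel_measurable (path_space \<Otimes>\<^sub>M (borel :: real measure))" if "0 \<le> t" for t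
    using that unfolding path_space_def
    by (intro measurable_compose[OF measurable_fst measurable_component_singleton]) auto
  show "B t \<in> borel_measurable F" if "0 \<le> t"
    using measurable_compose[OF h B[OF that]] that by (simp add: sample_path_def)
  show "T \<in> borel_measurable F"
    using measurable_compose[OF h measurable_snd] by simp
qed

text \<open>The path and the clock are frozen while the event times are averaged out. The products are
  cut off at \<open>n\<close> factors so that they are visibly measurable in the outcome and the event times
  jointly; the limit in \<open>n\<close> is taken after the two averages have been separated.\<close>

lemma (in prob_space) thinned_product_tendsto_feynman_kac:
  fixes q h :: "torus \<Rightarrow> real"
  assumes lam: "0 < lam" and q_max: "0 < q_max"
    and q: "q \<in> borel_measurable borel" "\<And>x. 0 \<le> q x \<and> q x \<le> q_max"
    and h: "h \<in> borel_measurable borel" "\<And>x. 0 \<le> h x \<and> h x \<le> lam"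
    and cont: "\<And>\<omega>. \<omega> \<in> space M \<Longrightarrow> continuous_on {0..} (\<lambda>t. B t \<omega>)"
    and path: "sample_path B \<in> measurable M path_space"
    and T: "T \<in> borel_measurable M" "\<And>\<omega>. \<omega> \<in> space M \<Longrightarrow> 0 \<le> T \<omega>"
    and poisson: "homogeneous_poisson_process M q_max \<tau>"
    and indep: "indep_pair M (path_space \<Otimes>\<^sub>M borel) (\<lambda>\<omega>. (sample_path B \<omega>, T \<omega>))
         (\<Pi>\<^sub>M r\<in>UNIV. borel) (\<lambda>\<omega> r. \<tau> r \<omega>)"
  shows "(\<lambda>n. expectation (\<lambda>\<omega>. (\<Prod>r<n. 1 - of_bool (\<tau> r \<omega> \<le> T \<omega>) * (q (B (\<tau> r \<omega>) \<omega>) / q_max)) *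
      (h (B (T \<omega>) \<omega>) / lam))) \<longlonglongrightarrow> feynman_kac M B T lam q h"
proof -
  define F where "F = vimage_algebra (space M) (\<lambda>\<omega>. (sample_path B \<omega>, T \<omega>)) (path_space \<Otimes>\<^sub>M borel)"
  define L :: "(nat \<Rightarrow> real) measure" where "L = (\<Pi>\<^sub>M r\<in>UNIV. borel)"
  have space_F: "space F = space M" by (simp add: F_def)
  note F_meas = path_clock_components_measurable[OF path T(1), folded F_def]
  have TF[measurable]: "T \<in> borel_measurable F" by (rule F_meas)
  define f where "f \<omega> = h (B (T \<omega>) \<omega>) / lam" for \<omega>
  have f01: "0 \<le> f \<omega>" "f \<omega> \<le> 1" for \<omega>
    using h(2) lam by (auto simp: f_def)
  have "(\<lambda>\<omega>. B (T \<omega>) \<omega>) \<in> borel_measurable F"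
    by (rule measurable_at_random_time) (use cont T F_meas in \<open>auto simp: space_F\<close>)
  from measurable_compose[OF this h(1)] have fF[measurable]: "f \<in> borel_measurable F"
    unfolding f_def by measurable
  define \<Phi> where "\<Phi> n = (\<lambda>(\<omega>, y :: nat \<Rightarrow> real).
      (\<Prod>r<n. 1 - of_bool (y r \<le> T \<omega>) * (q (B (max 0 (y r)) \<omega>) / q_max)) * f \<omega>)" for n :: nat
  have prod01: "norm (\<Prod>r<n. 1 - of_bool (b r) * (q (x r) / q_max)) \<le> 1" for n :: nat and b x
    unfolding prod_norm[symmetric]
    using q(2) q_max by (intro prod_le_1) (auto simp: of_bool_def)
  have \<Phi>01: "norm (\<Phi> n x) \<le> 1" for n x
    unfolding \<Phi>_def case_prod_unfold norm_mult using prod01 f01 by (intro mult_le_one) auto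
  have \<Phi>_meas: "\<Phi> n \<in> borel_measurable (F \<Otimes>\<^sub>M L)" for n
  proof -
    have [measurable]: "(\<lambda>x. snd x r) \<in> borel_measurable (F \<Otimes>\<^sub>M L)" for r
      unfolding L_def by measurable
    have "(\<lambda>x. B (max 0 (snd x r)) (fst x)) \<in> borel_measurable (F \<Otimes>\<^sub>M L)" for r
    proof (rule measurable_at_random_time[where X = "\<lambda>t x. B t (fst x)"])
      show "(\<lambda>x. B t (fst x)) \<in> borel_measurable (F \<Otimes>\<^sub>M L)" if "0 \<le> t" for t
        using F_meas(1)[OF that] by measurable
    qed (use cont in \<open>auto simp: space_pair_measure space_F\<close>)
    from measurable_compose[OF this q(1)]
    have [measurable]: "(\<lambda>x. q (B (max 0 (snd x r)) (fst x))) \<in> borel_measurable (F \<Otimes>\<^sub>M L)" for r .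
    show ?thesis unfolding \<Phi>_def case_prod_unfold by measurable
  qed
  have \<Phi>_eq: "\<Phi> n (\<omega>, \<lambda>r. \<tau> r \<omega>') =
      (\<Prod>r<n. 1 - of_bool (\<tau> r \<omega>' \<le> T \<omega>) * (q (B (\<tau> r \<omega>') \<omega>) / q_max)) * f \<omega>"
    if "\<omega>' \<in> space M" for n \<omega> \<omega>'
    using poisson_times(1)[OF poisson that] by (simp add: \<Phi>_def max_absorb2)
  note freeze = expectation_freeze[OF indep, folded F_def L_def, OF \<Phi>_meas \<Phi>01]
  define U where "U \<omega> = exp (- (LINT t:{0..T \<omega>}|lborel. q (B t \<omega>))) * f \<omega>" for \<omega>
  have lim: "(\<lambda>n. expectation (\<lambda>\<omega>'. \<Phi> n (\<omega>, \<lambda>r. \<tau> r \<omega>'))) \<longlonglongrightarrow> U \<omega>" if "\<omega> \<in> space M" for \<omega>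
  proof -
    have "expectation (\<lambda>\<omega>'. \<Phi> n (\<omega>, \<lambda>r. \<tau> r \<omega>')) =
        expectation (\<lambda>\<omega>'. \<Prod>r<n. 1 - of_bool (\<tau> r \<omega>' \<le> T \<omega>) * (q (B (\<tau> r \<omega>') \<omega>) / q_max)) * f \<omega>" for n
      by (simp add: \<Phi>_eq cong: Bochner_Integration.integral_cong)
    then show ?thesis
      unfolding U_def
      by (simp only:) (intro tendsto_mult tendsto_const
          no_kill_along_path[OF poisson q_max cont[OF that] q])
  qed
  have "(\<lambda>n. expectation (\<lambda>\<omega>. expectation (\<lambda>\<omega>'. \<Phi> n (\<omega>, \<lambda>r. \<tau> r \<omega>')))) \<longlonglongrightarrow> expectation U"
  proof (rule integral_dominated_convergence[where w = "\<lambda>_. 1"])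
    show "U \<in> borel_measurable M"
      by (rule borel_measurable_LIMSEQ_metric[OF freeze(2) lim])
    have "norm (expectation (\<lambda>\<omega>'. \<Phi> n (\<omega>, \<lambda>r. \<tau> r \<omega>'))) \<le> 1" for n \<omega>
    proof (cases "integrable M (\<lambda>\<omega>'. \<Phi> n (\<omega>, \<lambda>r. \<tau> r \<omega>'))")
      case True
      then have "expectation (\<lambda>\<omega>'. norm (\<Phi> n (\<omega>, \<lambda>r. \<tau> r \<omega>'))) \<le> 1"
        using \<Phi>01 by (intro integral_le_const integrable_norm) auto
      then show ?thesis
        by (rule order_trans[OF integral_norm_bound])
    next
      \<comment> \<open>A function that is not integrable has integral zero by convention.\<close>
      case False
      then show ?thesis by (simp add: not_integrable_integral_eq)
    qed
    then show "AE \<omega> in M. norm (expectation (\<lambda>\<omega>'. \<Phi> n (\<omega>, \<lambda>r. \<tau> r \<omega>'))) \<le> 1" for n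
      by simp
  qed (use freeze(2) lim in auto)
  also have "expectation U = feynman_kac M B T lam q h"
    by (simp add: feynman_kac_def U_def[abs_def] f_def)
  also have "(\<lambda>n. expectation (\<lambda>\<omega>. expectation (\<lambda>\<omega>'. \<Phi> n (\<omega>, \<lambda>r. \<tau> r \<omega>')))) =
      (\<lambda>n. expectation (\<lambda>\<omega>. (\<Prod>r<n. 1 - of_bool (\<tau> r \<omega> \<le> T \<omega>) * (q (B (\<tau> r \<omega>) \<omega>) / q_max)) *
        (h (B (T \<omega>) \<omega>) / lam)))"
    unfolding freeze(1)[symmetric]
    by (intro ext Bochner_Integration.integral_cong) (auto simp: \<Phi>_eq f_def)
  finally show ?thesis .
qed

lemma (in prob_space) distr_bool_eq_bernoulli_pmf:
  assumes J[measurable]: "J \<in> measurable M (count_space UNIV)"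
  shows "distr M (count_space UNIV) J = measure_pmf (bernoulli_pmf (prob {\<omega> \<in> space M. J \<omega>}))"
proof (rule measure_eqI_countable[of _ UNIV])
  fix b
  let ?u = "prob {\<omega> \<in> space M. J \<omega>}"
  have "prob {\<omega> \<in> space M. \<not> J \<omega>} = 1 - ?u"
    by (rule prob_neg) measurable
  then have "prob {\<omega> \<in> space M. J \<omega> = b} = pmf (bernoulli_pmf ?u) b"
    by (cases b) (simp_all add: prob_le_1)
  moreover have "emeasure (distr M (count_space UNIV) J) {b} = prob {\<omega> \<in> space M. J \<omega> = b}"
    by (subst emeasure_distr)
      (auto simp: emeasure_eq_measure intro!: arg_cong[where f = prob])
  ultimately show "emeasure (distr M (count_space UNIV) J) {b} =
      emeasure (measure_pmf (bernoulli_pmf ?u)) {b}"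
    by (simp add: emeasure_pmf_single)
qed auto

theorem theorem4p1:
  fixes M :: "'w measure"
    and lam q_max :: real
    and q h :: "torus \<Rightarrow> real"
    and s :: torus
    and B :: "real \<Rightarrow> 'w \<Rightarrow> torus"
    and T :: "'w \<Rightarrow> real"
    and \<tau> :: "nat \<Rightarrow> 'w \<Rightarrow> real"
    and K :: "nat \<Rightarrow> 'w \<Rightarrow> bool"
    and H :: "'w \<Rightarrow> bool"
  assumes "prob_space M"
    and "lam > 0" and "q_max > 0"
    and "q \<in> borel_measurable borel" and "\<And>x. 0 \<le> q x \<and> q x \<le> q_max"
    and "h \<in> borel_measurable borel" and "\<And>x. 0 \<le> h x \<and> h x \<le> lam"
    and brownian: "torus_brownian_motion M s B"
    and clock: "distributed M lborel T (exponential_density lam)"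
      "\<And>\<omega>. \<omega> \<in> space M \<Longrightarrow> 0 \<le> T \<omega>"
    and clock_indep: "indep_pair M path_space (sample_path B) borel T"
    and poisson: "homogeneous_poisson_process M q_max \<tau>"
    and poisson_indep:
      "indep_pair M (path_space \<Otimes>\<^sub>M borel) (\<lambda>\<omega>. (sample_path B \<omega>, T \<omega>))
         (\<Pi>\<^sub>M r\<in>UNIV. borel) (\<lambda>\<omega> r. \<tau> r \<omega>)"
    and killing_marks:
      "\<And>r. bernoulli_given M (history_space {..<r}) (history B T \<tau> K {..<r})
         (\<lambda>\<omega>. q (B (\<tau> r \<omega>) \<omega>) / q_max) (K r)"
    and final_draw:
      "bernoulli_given M (history_space UNIV) (history B T \<tau> K UNIV)
         (\<lambda>\<omega>. h (B (T \<omega>) \<omega>) / lam) H"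
  shows "0 \<le> feynman_kac M B T lam q h \<and> feynman_kac M B T lam q h \<le> 1 \<and>
    distr M (count_space UNIV) (returned_value T \<tau> K H) =
      measure_pmf (bernoulli_pmf (feynman_kac M B T lam q h))"
proof -
  interpret prob_space M by fact
  note q = assms(4,5) and h = assms(6,7)
  have cont: "continuous_on {0..} (\<lambda>t. B t \<omega>)" if "\<omega> \<in> space M" for \<omega>
    using brownian that unfolding torus_brownian_motion_def by blast
  have path: "sample_path B \<in> measurable M path_space" and T[measurable]: "T \<in> borel_measurable M"
    using clock_indep unfolding indep_pair_def by auto
  have \<tau>[measurable]: "\<tau> r \<in> borel_measurable M" for r
    using poisson unfolding homogeneous_poisson_process_def by blast
  have K[measurable]: "K r \<in> measurable M (count_space UNIV)" for r
    using killing_marks unfolding bernoulli_given_def by blast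
  have H[measurable]: "H \<in> measurable M (count_space UNIV)"
    using final_draw unfolding bernoulli_given_def by blast
  define a :: "nat \<Rightarrow> 'w \<Rightarrow> real" where "a r \<omega> = of_bool (\<tau> r \<omega> \<le> T \<omega>)" for r \<omega>
  define p where "p r \<omega> = q (B (\<tau> r \<omega>) \<omega>) / q_max" for r \<omega>
  define f where "f \<omega> = h (B (T \<omega>) \<omega>) / lam" for \<omega>
  define survive where "survive \<omega> \<longleftrightarrow> (\<forall>r. \<not> (\<tau> r \<omega> \<le> T \<omega> \<and> K r \<omega>))" for \<omega>
  have p01: "0 \<le> p r \<omega>" "p r \<omega> \<le> 1" for r \<omega>
    using q(2) \<open>q_max > 0\<close> by (auto simp: p_def)
  have f01: "0 \<le> f \<omega>" "f \<omega> \<le> 1" for \<omega>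
    using h(2) \<open>lam > 0\<close> by (auto simp: f_def)
  define F where "F I = vimage_algebra (space M) (history B T \<tau> K I) (history_space I)" for I
  have space_F: "space (F I) = space M" for I by (simp add: F_def)
  have F_meas: "B t \<in> borel_measurable (F I)" if "0 \<le> t"
    "history B T \<tau> K I \<in> measurable M (history_space I)" for t I
    using history_components_measurable(1)[OF that(2,1)] by (simp add: F_def)
  have hist: "history B T \<tau> K {..<r} \<in> measurable M (history_space {..<r})"
    "history B T \<tau> K UNIV \<in> measurable M (history_space UNIV)" for r
    using killing_marks final_draw unfolding bernoulli_given_def by blast+
  have meas: "a r \<in> borel_measurable (F I)" "p r \<in> borel_measurable (F I)" "f \<in> borel_measurable (F I)"
    if I: "history B T \<tau> K I \<in> measurable M (history_space I)" for I r
  proof -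
    note c = history_components_measurable[OF I, folded F_def]
    have [measurable]: "T \<in> borel_measurable (F I)" "\<tau> r \<in> borel_measurable (F I)" for r
      by (rule c)+
    show "a r \<in> borel_measurable (F I)" unfolding a_def by measurable
    have "(\<lambda>\<omega>. B (\<tau> r \<omega>) \<omega>) \<in> borel_measurable (F I)"
      by (rule measurable_at_random_time)
        (use c cont poisson_times(1)[OF poisson] in \<open>auto simp: space_F\<close>)
    from measurable_compose[OF this q(1)] show "p r \<in> borel_measurable (F I)"
      unfolding p_def by measurable
    have "(\<lambda>\<omega>. B (T \<omega>) \<omega>) \<in> borel_measurable (F I)"
      by (rule measurable_at_random_time) (use c cont clock(2) in \<open>auto simp: space_F\<close>)
    from measurable_compose[OF this h(1)] show "f \<in> borel_measurable (F I)"
      unfolding f_def by measurable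
  qed
  have "subalgebra M (F UNIV)"
    unfolding subalgebra_def F_def using hist(2) measurable_space[OF hist(2)]
    by (auto simp: sets_vimage_algebra2 Pi_iff)
  then have fM[measurable]: "f \<in> borel_measurable M"
    by (rule measurable_from_subalg[OF _ meas(3)[OF hist(2)]])
  define Q where "Q n \<omega> = (\<Prod>r<n. 1 - a r \<omega> * of_bool (K r \<omega>))" for n \<omega>
  have Q_meas[measurable]: "Q n \<in> borel_measurable M" for n
    unfolding Q_def a_def by measurable
  have survive_meas[measurable]: "Measurable.pred M survive"
    unfolding survive_def by measurable
  \<comment> \<open>Once \<open>n\<close> reaches the number of event times up to \<open>T\<close>, the product is the indicator of survival.\<close>
  have "(\<lambda>n. expectation (\<lambda>\<omega>. Q n \<omega> * f \<omega>)) \<longlonglongrightarrow> expectation (\<lambda>\<omega>. of_bool (survive \<omega>) * f \<omega>)"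
  proof (rule integral_dominated_convergence[where w = "\<lambda>_. 1"])
    show "AE \<omega> in M. (\<lambda>n. Q n \<omega> * f \<omega>) \<longlonglongrightarrow> of_bool (survive \<omega>) * f \<omega>"
    proof (intro AE_I2 tendsto_mult tendsto_const tendsto_eventually)
      fix \<omega>
      assume "\<omega> \<in> space M"
      from poisson_times(3)[OF poisson this, of "T \<omega>"]
      show "\<forall>\<^sub>F n in sequentially. Q n \<omega> = of_bool (survive \<omega>)"
      proof eventually_elim
        case (elim n)
        show ?case
        proof (cases "survive \<omega>")
          case True
          then show ?thesis by (auto simp: Q_def a_def survive_def intro!: prod.neutral)
        next
          case False
          then obtain r where "\<tau> r \<omega> \<le> T \<omega>" "K r \<omega>" unfolding survive_def by blast
          then have "r < n" "1 - a r \<omega> * of_bool (K r \<omega>) = 0" using elim by (auto simp: a_def)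
          then have "Q n \<omega> = 0" unfolding Q_def by (intro prod_zero bexI[of _ r]) auto
          then show ?thesis using False by simp
        qed
      qed
    qed
    have "norm (Q n \<omega>) \<le> 1" for n \<omega>
      unfolding Q_def prod_norm[symmetric] by (intro prod_le_1) (auto simp: a_def)
    then show "AE \<omega> in M. norm (Q n \<omega> * f \<omega>) \<le> 1" for n
      unfolding norm_mult using f01 by (intro AE_I2 mult_le_one) auto
  qed auto
  also have "(\<lambda>n. expectation (\<lambda>\<omega>. Q n \<omega> * f \<omega>)) =
      (\<lambda>n. expectation (\<lambda>\<omega>. (\<Prod>r<n. 1 - a r \<omega> * p r \<omega>) * f \<omega>))"
    unfolding Q_def
  proof (intro ext expectation_replace_marks[where \<G> = "\<lambda>r. F {..<r}"])
    show "bernoulli_given M (history_space {..<r}) (history B T \<tau> K {..<r}) (p r) (K r)" for r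
      using killing_marks[of r] by (simp add: p_def[abs_def])
    show "K i \<in> measurable (F {..<r}) (count_space UNIV)" if "i < r" for i r
      using history_components_measurable(4)[OF hist(1), of i r] that by (simp add: F_def)
    show "F {..<r} = vimage_algebra (space M) (history B T \<tau> K {..<r}) (history_space {..<r})" for r
      by (rule F_def)
    show "0 \<le> a i \<omega>" "a i \<omega> \<le> 1" for i \<omega>
      by (simp_all add: a_def)
  qed (rule meas[OF hist(1)] p01 f01)+
  finally have "(\<lambda>n. expectation (\<lambda>\<omega>. (\<Prod>r<n. 1 - a r \<omega> * p r \<omega>) * f \<omega>))
      \<longlonglongrightarrow> expectation (\<lambda>\<omega>. of_bool (survive \<omega>) * f \<omega>)" .
  moreover have "(\<lambda>n. expectation (\<lambda>\<omega>. (\<Prod>r<n. 1 - a r \<omega> * p r \<omega>) * f \<omega>))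
      \<longlonglongrightarrow> feynman_kac M B T lam q h"
    unfolding a_def p_def f_def
    by (rule thinned_product_tendsto_feynman_kac[OF \<open>lam > 0\<close> \<open>q_max > 0\<close> q h cont path T clock(2)
        poisson poisson_indep])
  ultimately have "expectation (\<lambda>\<omega>. of_bool (survive \<omega>) * f \<omega>) = feynman_kac M B T lam q h"
    by (rule LIMSEQ_unique)
  \<comment> \<open>Survival is decided by the history preceding the final draw.\<close>
  moreover have "expectation (\<lambda>\<omega>. of_bool (survive \<omega>) * of_bool (H \<omega>) :: real) =
      expectation (\<lambda>\<omega>. of_bool (survive \<omega>) * f \<omega>)"
  proof (rule bernoulli_given_expectation[where c = 1])
    show "bernoulli_given M (history_space UNIV) (history B T \<tau> K UNIV) f H"
      using final_draw by (simp add: f_def[abs_def])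
    note c = history_components_measurable[OF hist(2), folded F_def]
    have [measurable]: "T \<in> borel_measurable (F UNIV)" "\<tau> r \<in> borel_measurable (F UNIV)"
      "K r \<in> measurable (F UNIV) (count_space UNIV)" for r
      by (rule c UNIV_I)+
    have "Measurable.pred (F UNIV) survive"
      unfolding survive_def by measurable
    then have "(\<lambda>\<omega>. of_bool (survive \<omega>) :: real) \<in> borel_measurable (F UNIV)"
      by measurable
    then show "(\<lambda>\<omega>. of_bool (survive \<omega>) :: real) \<in>
        borel_measurable (vimage_algebra (space M) (history B T \<tau> K UNIV) (history_space UNIV))"
      by (simp add: F_def)
  qed auto
  moreover have "expectation (\<lambda>\<omega>. of_bool (survive \<omega>) * of_bool (H \<omega>) :: real) =
      prob {\<omega> \<in> space M. returned_value T \<tau> K H \<omega>}"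
  proof -
    have "expectation (\<lambda>\<omega>. of_bool (survive \<omega>) * of_bool (H \<omega>) :: real) =
        expectation (indicator {\<omega> \<in> space M. returned_value T \<tau> K H \<omega>})"
      by (intro Bochner_Integration.integral_cong)
        (auto simp: survive_def returned_value_def indicator_def)
    also have "\<dots> = prob {\<omega> \<in> space M. returned_value T \<tau> K H \<omega>}"
      by (auto intro!: arg_cong[where f = prob])
    finally show ?thesis .
  qed
  ultimately have u: "feynman_kac M B T lam q h = prob {\<omega> \<in> space M. returned_value T \<tau> K H \<omega>}"
    by simp
  have "returned_value T \<tau> K H \<in> measurable M (count_space UNIV)"
    unfolding returned_value_def[abs_def] by measurable
  from distr_bool_eq_bernoulli_pmf[OF this] show ?thesis
    unfolding u by (simp add: prob_le_1)
qed

end
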